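(* Let $\hat R:\mathbb{R}^p\times\mathbb{R}^q_+\to\mathbb{R}\cup\{+\infty\}$ be lower semicontinuous and level compact. Then $\mathcal{L}+\hat R$ is level compact (on $\mathbb{R}^p\times\mathbb{R}^q_+$), and the optimization problem $$\min_{\beta\in\mathbb{R}^p,\ \gamma\in\mathbb{R}^q_+}\ \mathcal{L}(\beta,\gamma)+\hat R(\beta,\gamma)$$ has a solution.
   Context: Fix integers $m,p,q\ge1$, $n_1,\dots,n_m\ge1$ and, for $i=1,\dots,m$, data $X_i\in\mathbb{R}^{n_i\times p}$, $Z_i\in\mathbb{R}^{n_i\times q}$, $Y_i\in\mathbb{R}^{n_i}$ and symmetric positive definite $\Lambda_i\in\mathbb{R}^{n_i\times n_i}$. For $\gamma\in\mathbb{R}^q_+$ let $\Omega_i(\gamma):=Z_i\,\mathrm{Diag}(\gamma)Z_i^T+\Lambda_i$, and for $(\beta,\gamma)\in\mathbb{R}^p\times\mathbb{R}^q_+$ let $$\mathcal{L}(\beta,\gamma):=\sum_{i=1}^m\tfrac12(Y_i-X_i\beta)^T\Omega_i(\gamma)^{-1}(Y_i-X_i\beta)+\tfrac12\ln\det\Omega_i(\gamma).$$ A function $F$ with values in $\mathbb{R}\cup\{+\infty\}$ is called level compact if its epigraph $\{(x,\nu): F(x)\le\nu\}$ is closed and the set $\{x: F(x)\le\nu\}$ is bounded for every $\nu\in\mathbb{R}$. A solution is a point of the feasible set attaining the infimum. *)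

theory Defs
  imports
    "HOL-Analysis.Analysis"
    "Jordan_Normal_Form.Determinant"
    "Jordan_Normal_Form.Gauss_Jordan_Elimination"
begin

(* Both libraries use "$" and "\<bullet>" for vectors. Below, "$" is the component of real^'n
   and "\<bullet>" the scalar product of Jordan_Normal_Form. *)
no_notation vec_index (infixl \<open>$\<close> 100)
unbundle no inner_syntax

text \<open>
  The sizes \<open>n i\<close> of the data matrices vary with \<open>i\<close>, so these matrices are the
  explicitly sized ones of Jordan_Normal_Form. The variables live in the fixed spaces
  \<open>real^'p\<close> and \<open>real^'q\<close>, whose topology and metric are those of HOL-Analysis.
  The two representations are linked by the library enumeration
  \<open>from_nat_into UNIV\<close>, which is a bijection from \<open>{..<CARD('p)}\<close> onto \<open>'p\<close>.
\<close>

definition coords :: "real^'k \<Rightarrow> real Matrix.vec" where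
  "coords x = Matrix.vec CARD('k) (\<lambda>j. x $ from_nat_into UNIV j)"

definition Diag :: "real^'k \<Rightarrow> real mat" where
  "Diag x = mat_diag CARD('k) (\<lambda>j. x $ from_nat_into UNIV j)"

definition sym_pos_def :: "nat \<Rightarrow> real mat \<Rightarrow> bool" where
  "sym_pos_def n A \<longleftrightarrow> A \<in> carrier_mat n n \<and> A\<^sup>T = A \<and>
     (\<forall>v \<in> carrier_vec n. v \<noteq> 0\<^sub>v n \<longrightarrow> v \<bullet> (A *\<^sub>v v) > 0)"

text \<open>\<open>mat_inverse\<close> is \<open>None\<close> exactly for non-invertible matrices.\<close>

definition inv_mat :: "real mat \<Rightarrow> real mat" where
  "inv_mat A = the (mat_inverse A)"

definition Omega :: "real mat \<Rightarrow> real mat \<Rightarrow> real^'q \<Rightarrow> real mat" where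
  "Omega Z \<Lambda> \<gamma> = Z * Diag \<gamma> * Z\<^sup>T + \<Lambda>"

definition neg_log_lik ::
  "nat \<Rightarrow> (nat \<Rightarrow> real mat) \<Rightarrow> (nat \<Rightarrow> real mat) \<Rightarrow> (nat \<Rightarrow> real Matrix.vec) \<Rightarrow> (nat \<Rightarrow> real mat)
     \<Rightarrow> (real^'p) \<times> (real^'q) \<Rightarrow> real" where
  "neg_log_lik m X Z Y \<Lambda> = (\<lambda>(\<beta>, \<gamma>).
     \<Sum>i = 1..m.
         1/2 * ((Y i - X i *\<^sub>v coords \<beta>) \<bullet>
                (inv_mat (Omega (Z i) (\<Lambda> i) \<gamma>) *\<^sub>v (Y i - X i *\<^sub>v coords \<beta>)))
       + 1/2 * ln (Determinant.det (Omega (Z i) (\<Lambda> i) \<gamma>)))"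

definition nonneg_orthant :: "(real^'q) set" where
  "nonneg_orthant = {\<gamma>. \<forall>j. 0 \<le> \<gamma> $ j}"

text \<open>
  An extended-real function on a subset \<open>S\<close> is given by a total function of which only
  the values on \<open>S\<close> matter. The set \<open>S\<close> is closed in the application, so
  closedness of the epigraph relative to \<open>S\<close> and in the whole space coincide.
\<close>

definition lower_semicontinuous_on :: "'a::topological_space set \<Rightarrow> ('a \<Rightarrow> ereal) \<Rightarrow> bool" where
  "lower_semicontinuous_on S F \<longleftrightarrow> (\<forall>x\<in>S. F x \<le> Liminf (at x within S) F)"

definition level_compact_on :: "'a::metric_space set \<Rightarrow> ('a \<Rightarrow> ereal) \<Rightarrow> bool" where
  "level_compact_on S F \<longleftrightarrow>
     closed {(x, \<nu>::real). x \<in> S \<and> F x \<le> ereal \<nu>} \<and>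
     (\<forall>\<nu>::real. bounded {x \<in> S. F x \<le> ereal \<nu>})"

definition is_minimizer_on :: "'a set \<Rightarrow> ('a \<Rightarrow> ereal) \<Rightarrow> 'a \<Rightarrow> bool" where
  "is_minimizer_on S F x \<longleftrightarrow> x \<in> S \<and> F x = (INF y\<in>S. F y)"

end

theory Submission
  imports Defs
begin

text \<open>
  Adding \<open>\<gamma>\<^sub>k z\<^sub>k z\<^sub>k\<^sup>T\<close> to a positive definite \<open>A\<close> multiplies its determinant by
  \<open>1 + \<gamma>\<^sub>k z\<^sub>k\<^sup>T A\<^sup>-\<^sup>1 z\<^sub>k \<ge> 1\<close>, so \<open>det \<Omega>\<^sub>i(\<gamma>) \<ge> det \<Lambda>\<^sub>i\<close>. The quadratic terms being
  nonnegative, the likelihood term is bounded below, and it is continuous by Cramer's rule.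
  Hence the level sets of the sum lie in level sets of \<open>R\<close>, and the epigraph of the sum is the
  preimage of the epigraph of \<open>R\<close> under the continuous map \<open>(x, \<nu>) \<mapsto> (x, \<nu> - L x)\<close>. A minimizer
  exists because the sublevel sets above the infimum form a chain of nonempty compact sets.
\<close>

section \<open>Determinant identities and inverses of sized matrices\<close>

text \<open>Sylvester's identity. The products of \<open>?M\<close> and \<open>?N\<close> in the two
  orders are block lower triangular, and their determinants are the two sides. With
  \<open>k = 1\<close> it turns a rank one perturbation into a scalar.\<close>

lemma det_one_plus_mult_commute:
  fixes A B :: "'a :: idom mat"
  assumes A: "A \<in> carrier_mat n k" and B: "B \<in> carrier_mat k n"
  shows "Determinant.det (1\<^sub>m n + A * B) = Determinant.det (1\<^sub>m k + B * A)"
proof -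
  let ?M = "four_block_mat (1\<^sub>m n) (- A) B (1\<^sub>m k)"
  let ?N = "four_block_mat (1\<^sub>m n) A (0\<^sub>m k n) (1\<^sub>m k)"
  have M: "?M \<in> carrier_mat (n + k) (n + k)" and N: "?N \<in> carrier_mat (n + k) (n + k)"
    by auto
  have detN: "Determinant.det ?N = 1"
    by (subst det_four_block_mat_lower_left_zero[of _ n _ k]) (use A in auto)
  have NM: "?N * ?M = four_block_mat (1\<^sub>m n + A * B) (0\<^sub>m n k) B (1\<^sub>m k)"
    by (subst mult_four_block_mat[of _ n n _ k _ k _ _ n _ k])
      (use A B in \<open>auto intro!: cong_four_block_mat\<close>)
  have MN: "?M * ?N = four_block_mat (1\<^sub>m n) (0\<^sub>m n k) B (1\<^sub>m k + B * A)"
    by (subst mult_four_block_mat[of _ n n _ k _ k _ _ n _ k])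
      (use A B in \<open>auto intro!: cong_four_block_mat\<close>)
  have "Determinant.det (1\<^sub>m n + A * B) = Determinant.det (?N * ?M)"
    unfolding NM by (subst det_four_block_mat_upper_right_zero[of _ n _ k]) (use A B in auto)
  also have "\<dots> = Determinant.det (?M * ?N)"
    by (simp add: det_mult[OF M N] det_mult[OF N M])
  also have "\<dots> = Determinant.det (1\<^sub>m k + B * A)"
    unfolding MN by (subst det_four_block_mat_upper_right_zero[of _ n _ k]) (use A B in auto)
  finally show ?thesis .
qed

lemma transpose_smult_mat: "(c \<cdot>\<^sub>m A)\<^sup>T = c \<cdot>\<^sub>m A\<^sup>T"
  by (rule eq_matI) auto

lemma smult_mat_mult_vec:
  fixes A :: "'a::comm_semiring_0 mat"
  assumes "dim_vec v = dim_col A"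
  shows "(c \<cdot>\<^sub>m A) *\<^sub>v v = c \<cdot>\<^sub>v (A *\<^sub>v v)"
  using assms by (intro eq_vecI) (auto simp: scalar_prod_def sum_distrib_left mult.assoc intro!: sum.cong)

lemma inv_mat_properties:
  assumes A: "A \<in> carrier_mat n n" and nz: "Determinant.det A \<noteq> 0"
  shows "inv_mat A \<in> carrier_mat n n" "A * inv_mat A = 1\<^sub>m n" "inv_mat A * A = 1\<^sub>m n"
proof -
  obtain B where "mat_inverse A = Some B"
    using mat_inverse(1)[OF A, where b = "()"] det_non_zero_imp_unit[OF A nz, where b = "()"]
    by (cases "mat_inverse A") auto
  with mat_inverse(2)[OF A this]
  show "inv_mat A \<in> carrier_mat n n" "A * inv_mat A = 1\<^sub>m n" "inv_mat A * A = 1\<^sub>m n"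
    by (auto simp: inv_mat_def)
qed

text \<open>Cramer's rule, from cancelling \<open>A\<close> in \<open>A * adj_mat A\<close>, a
  multiple of the identity. It exposes the entries of the inverse as quotients of polynomials in the
  entries of \<open>A\<close>.\<close>

lemma inv_mat_eq_adj_mat:
  assumes A: "A \<in> carrier_mat n n" and nz: "Determinant.det A \<noteq> 0"
  shows "inv_mat A = inverse (Determinant.det A) \<cdot>\<^sub>m adj_mat A"
proof -
  note I = inv_mat_properties[OF A nz]
  note adj = adj_mat[OF A]
  have "adj_mat A = (inv_mat A * A) * adj_mat A"
    using I adj by simp
  also have "\<dots> = inv_mat A * (A * adj_mat A)"
    by (rule assoc_mult_mat[OF I(1) A adj(1)])
  also have "\<dots> = Determinant.det A \<cdot>\<^sub>m inv_mat A"
    unfolding adj(2) using I mult_smult_distrib[OF I(1) one_carrier_mat] by simp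
  finally have "adj_mat A = Determinant.det A \<cdot>\<^sub>m inv_mat A" .
  then show ?thesis
    using I(1) nz by (intro eq_matI) auto
qed

text \<open>The Leibniz formula is a polynomial in the entries. The size is fixed for every
  \<open>x\<close>, also outside \<open>S\<close>, so that the formula can be rewritten under the
  binder.\<close>

lemma continuous_on_det:
  fixes A :: "'a::topological_space \<Rightarrow> real mat"
  assumes A: "\<And>x. A x \<in> carrier_mat n n"
    and cont: "\<And>i j. i < n \<Longrightarrow> j < n \<Longrightarrow> continuous_on S (\<lambda>x. A x $$ (i, j))"
  shows "continuous_on S (\<lambda>x. Determinant.det (A x))"
  unfolding det_def'[OF A]
  by (intro continuous_intros cont) (auto dest: permutes_in_image)

lemma continuous_on_inv_mat:
  fixes A :: "'a::topological_space \<Rightarrow> real mat"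
  assumes A: "\<And>x. A x \<in> carrier_mat n n"
    and cont: "\<And>i j. i < n \<Longrightarrow> j < n \<Longrightarrow> continuous_on S (\<lambda>x. A x $$ (i, j))"
    and nz: "\<And>x. x \<in> S \<Longrightarrow> Determinant.det (A x) \<noteq> 0"
    and ij: "i < n" "j < n"
  shows "continuous_on S (\<lambda>x. inv_mat (A x) $$ (i, j))"
proof -
  have dims: "dim_row (A x) = n" "dim_col (A x) = n" for x
    using A[of x] by auto
  \<comment> \<open>The indices are swapped because the adjugate is the transpose of the cofactor
    matrix.\<close>
  have "continuous_on S (\<lambda>x. Determinant.det (mat_delete (A x) j i))"
    by (rule continuous_on_det[where n = "n - 1"])
      (use A ij in \<open>auto simp: mat_delete_def dims intro!: cont\<close>)
  then have "continuous_on S (\<lambda>x. inverse (Determinant.det (A x)) * cofactor (A x) j i)"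
    unfolding cofactor_def
    by (intro continuous_intros continuous_on_det[OF A cont]) (use nz in auto)
  moreover have "inv_mat (A x) $$ (i, j) = inverse (Determinant.det (A x)) * cofactor (A x) j i"
    if "x \<in> S" for x
    using ij nz[OF that] by (simp add: inv_mat_eq_adj_mat[OF A] adj_mat_def dims)
  ultimately show ?thesis
    by (simp cong: continuous_on_cong)
qed

section \<open>Positive definite matrices and their determinants\<close>

lemma sym_pos_def_carrier: "sym_pos_def n A \<Longrightarrow> A \<in> carrier_mat n n"
  by (simp add: sym_pos_def_def)

lemma sym_pos_def_pos:
  "sym_pos_def n A \<Longrightarrow> v \<in> carrier_vec n \<Longrightarrow> v \<noteq> 0\<^sub>v n \<Longrightarrow> 0 < v \<bullet> (A *\<^sub>v v)"
  by (simp add: sym_pos_def_def)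

lemma sym_pos_def_nonneg:
  assumes "sym_pos_def n A" "v \<in> carrier_vec n"
  shows "0 \<le> v \<bullet> (A *\<^sub>v v)"
proof (cases "v = 0\<^sub>v n")
  case True
  then show ?thesis using sym_pos_def_carrier[OF assms(1)] by simp
next
  case False
  then show ?thesis using sym_pos_def_pos[OF assms] by simp
qed

lemma sym_pos_def_one: "sym_pos_def n (1\<^sub>m n)"
proof -
  have "0 < v \<bullet> v" if v: "v \<in> carrier_vec n" "v \<noteq> 0\<^sub>v n" for v :: "real Matrix.vec"
  proof -
    obtain i where i: "i < n" "vec_index v i \<noteq> 0"
      using v by (metis carrier_vecD eq_vecI index_zero_vec)
    then show ?thesis
      unfolding scalar_prod_def using v
      by (intro sum_pos2[of _ i]) (auto simp: zero_less_mult_iff)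
  qed
  then show ?thesis by (simp add: sym_pos_def_def)
qed

text \<open>Used for the segment from the identity matrix to a positive definite one, along which
  the determinant is then nonzero.\<close>

lemma sym_pos_def_convex:
  assumes A: "sym_pos_def n A" and B: "sym_pos_def n B" and t: "0 \<le> t" "t \<le> 1"
  shows "sym_pos_def n ((1 - t) \<cdot>\<^sub>m A + t \<cdot>\<^sub>m B)"
  unfolding sym_pos_def_def
proof (intro conjI ballI impI)
  note carrier = sym_pos_def_carrier[OF A] sym_pos_def_carrier[OF B]
  show "(1 - t) \<cdot>\<^sub>m A + t \<cdot>\<^sub>m B \<in> carrier_mat n n"
    using carrier by simp
  show "((1 - t) \<cdot>\<^sub>m A + t \<cdot>\<^sub>m B)\<^sup>T = (1 - t) \<cdot>\<^sub>m A + t \<cdot>\<^sub>m B"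
    using carrier A B unfolding sym_pos_def_def by (simp add: transpose_add[of _ n n] transpose_smult_mat)
  fix v :: "real Matrix.vec"
  assume v: "v \<in> carrier_vec n" "v \<noteq> 0\<^sub>v n"
  have "v \<bullet> (((1 - t) \<cdot>\<^sub>m A + t \<cdot>\<^sub>m B) *\<^sub>v v) = (1 - t) * (v \<bullet> (A *\<^sub>v v)) + t * (v \<bullet> (B *\<^sub>v v))"
    using carrier v
    by (simp add: add_mult_distrib_mat_vec[of _ n n] scalar_prod_add_distrib[of _ n] smult_mat_mult_vec)
  \<comment> \<open>At \<open>t = 0\<close> the first summand is positive; for \<open>t > 0\<close>
    the second one is, while the first vanishes at \<open>t = 1\<close>.\<close>
  moreover have "0 < \<dots>"
    using t sym_pos_def_pos[OF A v] sym_pos_def_pos[OF B v]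
    by (cases "t = 0") (auto intro: add_nonneg_pos)
  ultimately show "0 < v \<bullet> (((1 - t) \<cdot>\<^sub>m A + t \<cdot>\<^sub>m B) *\<^sub>v v)"
    by simp
qed

text \<open>A singular matrix has a nonzero kernel vector, on which the quadratic form would
  vanish.\<close>

lemma sym_pos_def_det_nonzero:
  assumes "sym_pos_def n A"
  shows "Determinant.det A \<noteq> 0"
proof
  assume "Determinant.det A = 0"
  then obtain v where "v \<in> carrier_vec n" "v \<noteq> 0\<^sub>v n" "A *\<^sub>v v = 0\<^sub>v n"
    using det_0_iff_vec_prod_zero_field[OF sym_pos_def_carrier[OF assms]] by auto
  with sym_pos_def_pos[OF assms] show False
    by (metis less_irrefl scalar_prod_right_zero)
qed

text \<open>The determinant does not vanish along the segment from the identity matrix.\<close>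

lemma sym_pos_def_det_pos:
  assumes A: "sym_pos_def n A"
  shows "0 < Determinant.det A"
proof (rule ccontr)
  define f where "f t = Determinant.det ((1 - t) \<cdot>\<^sub>m 1\<^sub>m n + t \<cdot>\<^sub>m A)" for t :: real
  have "(1 - 0) \<cdot>\<^sub>m 1\<^sub>m n + 0 \<cdot>\<^sub>m A = 1\<^sub>m n" "(1 - 1) \<cdot>\<^sub>m 1\<^sub>m n + 1 \<cdot>\<^sub>m A = A"
    using sym_pos_def_carrier[OF A] by (auto intro!: eq_matI)
  then have f0: "f 0 = 1" and f1: "f 1 = Determinant.det A"
    by (simp_all only: f_def det_one)
  have "continuous_on {0..1} f"
    unfolding f_def
    by (rule continuous_on_det[where n = n])
      (use sym_pos_def_carrier[OF A] in \<open>auto intro!: continuous_intros\<close>)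
  moreover assume "\<not> 0 < Determinant.det A"
  \<comment> \<open>\<open>f\<close> falls from \<open>1\<close> to a value at most
    \<open>0\<close>, so it has a zero in between.\<close>
  ultimately obtain t where "0 \<le> t" "t \<le> 1" "f t = 0"
    using IVT2'[of f 1 0 0] f0 f1 by auto
  then show False
    using sym_pos_def_det_nonzero[OF sym_pos_def_convex[OF sym_pos_def_one A]] by (auto simp: f_def)
qed

text \<open>Substituting \<open>v = A *\<^sub>v ?w\<close> turns the form of the inverse at
  \<open>v\<close> into the form of \<open>A\<close> at \<open>?w\<close>. This serves both the rank
  one factor and the quadratic terms of the likelihood.\<close>

lemma sym_pos_def_inv_mat_nonneg:
  assumes A: "sym_pos_def n A" and v: "v \<in> carrier_vec n"
  shows "0 \<le> v \<bullet> (inv_mat A *\<^sub>v v)"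
proof -
  note I = inv_mat_properties[OF sym_pos_def_carrier[OF A] sym_pos_def_det_nonzero[OF A]]
  let ?w = "inv_mat A *\<^sub>v v"
  have w: "?w \<in> carrier_vec n" using I v by simp
  have "A *\<^sub>v ?w = v"
    using assoc_mult_mat_vec[OF sym_pos_def_carrier[OF A] I(1) v] I(2) v by simp
  then show ?thesis
    using sym_pos_def_nonneg[OF A w] comm_scalar_prod[OF v w] by simp
qed

text \<open>The added term contributes \<open>g\<close> times the squared length of
  \<open>W\<^sup>T *\<^sub>v v\<close>.\<close>

lemma sym_pos_def_add_outer:
  assumes A: "sym_pos_def n A" and W: "W \<in> carrier_mat n k" and g: "0 \<le> g"
  shows "sym_pos_def n (A + g \<cdot>\<^sub>m (W * W\<^sup>T))"
  unfolding sym_pos_def_def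
proof (intro conjI ballI impI)
  note carrier = sym_pos_def_carrier[OF A]
  show "A + g \<cdot>\<^sub>m (W * W\<^sup>T) \<in> carrier_mat n n"
    using carrier W by simp
  show "(A + g \<cdot>\<^sub>m (W * W\<^sup>T))\<^sup>T = A + g \<cdot>\<^sub>m (W * W\<^sup>T)"
    using A carrier W
    by (simp add: transpose_add[of _ n n] transpose_mult[of _ n k] transpose_smult_mat sym_pos_def_def)
  fix v :: "real Matrix.vec"
  assume v: "v \<in> carrier_vec n" "v \<noteq> 0\<^sub>v n"
  have WW: "W * W\<^sup>T \<in> carrier_mat n n" using W by simp
  let ?u = "W\<^sup>T *\<^sub>v v"
  have u: "?u \<in> carrier_vec k" using W by (intro carrier_vecI) simp
  have "v \<bullet> ((W * W\<^sup>T) *\<^sub>v v) = v \<bullet> (W *\<^sub>v ?u)"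
    using W v by simp
  also have "\<dots> = ?u \<bullet> ?u"
    using transpose_vec_mult_scalar[OF W u v(1)] by simp
  finally have outer: "0 \<le> v \<bullet> ((W * W\<^sup>T) *\<^sub>v v)"
    by (simp add: scalar_prod_def sum_nonneg)
  have "v \<bullet> ((A + g \<cdot>\<^sub>m (W * W\<^sup>T)) *\<^sub>v v) = v \<bullet> (A *\<^sub>v v) + g * (v \<bullet> ((W * W\<^sup>T) *\<^sub>v v))"
    using carrier W v mult_mat_vec_carrier[OF WW v(1)]
    by (simp add: add_mult_distrib_mat_vec[of _ n n] scalar_prod_add_distrib[of _ n]
        smult_mat_mult_vec del: assoc_mult_mat_vec)
  also have "\<dots> > 0"
    using sym_pos_def_pos[OF A v] outer g by (simp add: add_pos_nonneg)
  finally show "0 < v \<bullet> ((A + g \<cdot>\<^sub>m (W * W\<^sup>T)) *\<^sub>v v)" .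
qed

text \<open>The matrix determinant lemma: \<open>A\<close> is factored out on the left, and
  Sylvester's identity reduces the remaining factor to a 1 by 1 determinant that is at least 1. The
  vector is kept as a matrix \<open>W\<close> with one column so that this identity applies.\<close>

lemma det_le_det_add_rank_one:
  assumes A: "sym_pos_def n A" and W: "W \<in> carrier_mat n 1" and g: "0 \<le> g"
  shows "Determinant.det A \<le> Determinant.det (A + g \<cdot>\<^sub>m (W * W\<^sup>T))"
proof -
  note carrier = sym_pos_def_carrier[OF A]
  note I = inv_mat_properties[OF carrier sym_pos_def_det_nonzero[OF A]]
  let ?B = "inv_mat A" and ?V = "g \<cdot>\<^sub>m W\<^sup>T"
  have V: "?V \<in> carrier_mat 1 n" and BW: "?B * W \<in> carrier_mat n 1" and BWV: "?B * W * ?V \<in> carrier_mat n n"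
    using W I by auto
  have "A * (?B * W * ?V) = A * ?B * W * ?V"
    by (simp only: assoc_mult_mat[OF carrier BW V] assoc_mult_mat[OF carrier I(1) W])
  also have "\<dots> = g \<cdot>\<^sub>m (W * W\<^sup>T)"
    using I W mult_smult_distrib[of W n 1 "W\<^sup>T" n g] by simp
  finally have "A + g \<cdot>\<^sub>m (W * W\<^sup>T) = A * (1\<^sub>m n + ?B * W * ?V)"
    using carrier BWV by (simp add: mult_add_distrib_mat[of _ n n _ n])
  then have "Determinant.det (A + g \<cdot>\<^sub>m (W * W\<^sup>T))
      = Determinant.det A * Determinant.det (1\<^sub>m n + ?B * W * ?V)"
    using det_mult[OF carrier, of "1\<^sub>m n + ?B * W * ?V"] BWV by simp
  also have "Determinant.det (1\<^sub>m n + ?B * W * ?V) = Determinant.det (1\<^sub>m 1 + ?V * (?B * W))"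
    by (rule det_one_plus_mult_commute[OF BW V])
  also have "\<dots> = (1\<^sub>m 1 + ?V * (?B * W)) $$ (0, 0)"
    by (rule det_single) (use V BW in auto)
  also have "\<dots> = 1 + g * (col W 0 \<bullet> (?B *\<^sub>v col W 0))"
  proof -
    have "col (?B * W) 0 = ?B *\<^sub>v col W 0"
      by (rule col_mult2[OF I(1) W]) simp
    moreover have "row ?V 0 = g \<cdot>\<^sub>v col W 0"
      using W by auto
    ultimately show ?thesis
      using V BW W I by simp
  qed
  finally have "Determinant.det (A + g \<cdot>\<^sub>m (W * W\<^sup>T))
      = Determinant.det A * (1 + g * (col W 0 \<bullet> (?B *\<^sub>v col W 0)))" .
  moreover have "0 \<le> g * (col W 0 \<bullet> (?B *\<^sub>v col W 0))"
    using g W by (intro mult_nonneg_nonneg sym_pos_def_inv_mat_nonneg[OF A]) auto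
  ultimately show ?thesis
    using sym_pos_def_det_pos[OF A] by (simp add: distrib_left)
qed

text \<open>Entrywise the matrix is affine in the weights \<open>f\<close>; this drives both the
  induction on the weights and the continuity in \<gamma>.\<close>

lemma mult_mat_diag_transpose_add_index:
  fixes Z :: "real mat"
  assumes "Z \<in> carrier_mat n q" "L \<in> carrier_mat n n" "i < n" "j < n"
  shows "(Z * mat_diag q f * Z\<^sup>T + L) $$ (i, j) = (\<Sum>k<q. Z $$ (i, k) * f k * Z $$ (j, k)) + L $$ (i, j)"
  using assms
  by (subst mat_diag_mult_right[of _ n]) (auto simp: scalar_prod_def atLeast0LessThan)

text \<open>Induction on the number of nonzero weights: each one adds a rank one term.\<close>

lemma sym_pos_def_mult_mat_diag_transpose_add:
  assumes Z: "Z \<in> carrier_mat n q" and L: "sym_pos_def n L" and f: "\<And>k. k < q \<Longrightarrow> 0 \<le> f k"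
  shows "sym_pos_def n (Z * mat_diag q f * Z\<^sup>T + L)
    \<and> Determinant.det L \<le> Determinant.det (Z * mat_diag q f * Z\<^sup>T + L)"
proof -
  note carrier = sym_pos_def_carrier[OF L]
  \<comment> \<open>Weights from index \<open>r\<close> on are set to zero while the size
    \<open>q\<close> is kept, so consecutive matrices differ in one summand of each entry.\<close>
  define M where "M r = Z * mat_diag q (\<lambda>k. if k < r then f k else 0) * Z\<^sup>T + L" for r
  have M: "M r \<in> carrier_mat n n" for r
    using carrier by (simp add: M_def)
  have M_index: "M r $$ (i, j)
      = (\<Sum>k<q. Z $$ (i, k) * (if k < r then f k else 0) * Z $$ (j, k)) + L $$ (i, j)"
    if "i < n" "j < n" for r i j
    unfolding M_def by (rule mult_mat_diag_transpose_add_index[OF Z carrier that])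
  have "sym_pos_def n (M r) \<and> Determinant.det L \<le> Determinant.det (M r)" if "r \<le> q" for r
    using that
  proof (induction r)
    case 0
    have "M 0 = L"
      using M[of 0] carrier by (intro eq_matI) (auto simp: M_index)
    then show ?case using L by simp
  next
    case (Suc r)
    \<comment> \<open>Column \<open>r\<close> of \<open>Z\<close>, as a matrix with one
      column.\<close>
    let ?W = "Matrix.mat n 1 (\<lambda>(i, _). Z $$ (i, r))"
    have "M (Suc r) = M r + f r \<cdot>\<^sub>m (?W * ?W\<^sup>T)"
    proof (rule eq_matI)
      fix i j
      assume "i < dim_row (M r + f r \<cdot>\<^sub>m (?W * ?W\<^sup>T))" "j < dim_col (M r + f r \<cdot>\<^sub>m (?W * ?W\<^sup>T))"
      then have ij: "i < n" "j < n" by auto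
      have "(\<Sum>k<q. Z $$ (i, k) * (if k < Suc r then f k else 0) * Z $$ (j, k))
          = (\<Sum>k<q. Z $$ (i, k) * (if k < r then f k else 0) * Z $$ (j, k)
              + (if k = r then Z $$ (i, r) * f r * Z $$ (j, r) else 0))"
        by (intro sum.cong) auto
      also have "\<dots> = (\<Sum>k<q. Z $$ (i, k) * (if k < r then f k else 0) * Z $$ (j, k))
          + Z $$ (i, r) * f r * Z $$ (j, r)"
        using Suc.prems by (simp add: sum.distrib)
      finally show "M (Suc r) $$ (i, j) = (M r + f r \<cdot>\<^sub>m (?W * ?W\<^sup>T)) $$ (i, j)"
        using ij M[of r] by (simp add: M_index scalar_prod_def)
    qed (use M[of r] M[of "Suc r"] in auto)
    then show ?case
      using Suc f[of r] sym_pos_def_add_outer[of n "M r" ?W 1 "f r"]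
        det_le_det_add_rank_one[of n "M r" ?W "f r"] by auto
  qed
  \<comment> \<open>The cutoff at \<open>q\<close> changes no weight, since all indices lie below
    \<open>q\<close>.\<close>
  moreover have "M q = Z * mat_diag q f * Z\<^sup>T + L"
    unfolding M_def by (intro arg_cong2[of _ _ _ _ "(+)"] arg_cong2[of _ _ _ _ "(*)"] refl)
      (auto simp: mat_diag_def)
  ultimately show ?thesis by (metis order_refl)
qed

section \<open>The likelihood: lower bound and continuity\<close>

lemma
  fixes \<gamma> :: "real^'q"
  assumes "Z \<in> carrier_mat n CARD('q)" "sym_pos_def n \<Lambda>" "\<gamma> \<in> nonneg_orthant"
  shows sym_pos_def_Omega: "sym_pos_def n (Omega Z \<Lambda> \<gamma>)"
    and det_le_det_Omega: "Determinant.det \<Lambda> \<le> Determinant.det (Omega Z \<Lambda> \<gamma>)"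
  unfolding Omega_def Diag_def
  using sym_pos_def_mult_mat_diag_transpose_add[OF assms(1,2), of "\<lambda>k. \<gamma> $ from_nat_into UNIV k"] assms(3)
  by (auto simp: nonneg_orthant_def)

text \<open>The quadratic forms are dropped and the logarithm is monotone. The bound does not
  involve \<open>x\<close>, so a single shift of the level serves all points.\<close>

lemma neg_log_lik_bounded_below:
  fixes X Z \<Lambda> :: "nat \<Rightarrow> real mat" and x :: "(real^'p) \<times> (real^'q)"
  assumes X: "\<And>i. i \<in> {1..m} \<Longrightarrow> X i \<in> carrier_mat (n i) CARD('p)"
    and Z: "\<And>i. i \<in> {1..m} \<Longrightarrow> Z i \<in> carrier_mat (n i) CARD('q)"
    and L: "\<And>i. i \<in> {1..m} \<Longrightarrow> sym_pos_def (n i) (\<Lambda> i)"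
    and x: "x \<in> UNIV \<times> nonneg_orthant"
  shows "(\<Sum>i = 1..m. 1/2 * ln (Determinant.det (\<Lambda> i))) \<le> neg_log_lik m X Z Y \<Lambda> x"
proof (cases x)
  case (Pair \<beta> \<gamma>)
  have \<gamma>: "\<gamma> \<in> nonneg_orthant" using x Pair by simp
  show ?thesis
    unfolding Pair neg_log_lik_def prod.case
  proof (rule sum_mono)
    fix i assume i: "i \<in> {1..m}"
    let ?v = "Y i - X i *\<^sub>v coords \<beta>" and ?O = "Omega (Z i) (\<Lambda> i) \<gamma>"
    \<comment> \<open>Vector subtraction takes its dimension from the second operand, hence from the
      rows of \<open>X i\<close>.\<close>
    have "?v \<in> carrier_vec (n i)"
      using X[OF i] by (intro carrier_vecI) simp
    then have "0 \<le> ?v \<bullet> (inv_mat ?O *\<^sub>v ?v)"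
      by (rule sym_pos_def_inv_mat_nonneg[OF sym_pos_def_Omega[OF Z[OF i] L[OF i] \<gamma>]])
    moreover have "ln (Determinant.det (\<Lambda> i)) \<le> ln (Determinant.det ?O)"
      using det_le_det_Omega[OF Z[OF i] L[OF i] \<gamma>] sym_pos_def_det_pos[OF L[OF i]] by simp
    ultimately show "1/2 * ln (Determinant.det (\<Lambda> i))
        \<le> 1/2 * (?v \<bullet> (inv_mat ?O *\<^sub>v ?v)) + 1/2 * ln (Determinant.det ?O)"
      by simp
  qed
qed

lemma continuous_on_neg_log_lik:
  fixes X Z \<Lambda> :: "nat \<Rightarrow> real mat"
  assumes X: "\<And>i. i \<in> {1..m} \<Longrightarrow> X i \<in> carrier_mat (n i) CARD('p)"
    and Z: "\<And>i. i \<in> {1..m} \<Longrightarrow> Z i \<in> carrier_mat (n i) CARD('q)"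
    and Y: "\<And>i. i \<in> {1..m} \<Longrightarrow> Y i \<in> carrier_vec (n i)"
    and L: "\<And>i. i \<in> {1..m} \<Longrightarrow> sym_pos_def (n i) (\<Lambda> i)"
  shows "continuous_on (UNIV \<times> nonneg_orthant)
    (neg_log_lik m X Z Y \<Lambda> :: (real^'p) \<times> (real^'q) \<Rightarrow> real)"
  unfolding neg_log_lik_def case_prod_beta'
proof (rule continuous_on_sum)
  fix i assume i: "i \<in> {1..m}"
  let ?S = "UNIV \<times> nonneg_orthant :: ((real^'p) \<times> (real^'q)) set"
  let ?v = "\<lambda>x :: (real^'p) \<times> (real^'q). Y i - X i *\<^sub>v coords (fst x)"
  let ?O = "\<lambda>x :: (real^'p) \<times> (real^'q). Omega (Z i) (\<Lambda> i) (snd x)"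
  note \<Lambda> = sym_pos_def_carrier[OF L[OF i]]
  have v: "?v x \<in> carrier_vec (n i)" for x
    using X[OF i] by (intro carrier_vecI) simp
  have O: "?O x \<in> carrier_mat (n i) (n i)" for x
    using \<Lambda> by (simp add: Omega_def)
  have O_pos: "0 < Determinant.det (?O x)" if "x \<in> ?S" for x
    using that by (intro sym_pos_def_det_pos[OF sym_pos_def_Omega[OF Z[OF i] L[OF i]]]) auto
  \<comment> \<open>Restricted to \<open>?S\<close>: elsewhere \<open>?O x\<close> may be singular,
    and \<open>inv_mat\<close> is then \<open>the None\<close>.\<close>
  have inv: "inv_mat (?O x) \<in> carrier_mat (n i) (n i)" if "x \<in> ?S" for x
    using inv_mat_properties(1)[OF O] O_pos[OF that] by auto
  have cont_O: "continuous_on ?S (\<lambda>x. ?O x $$ (a, b))" if "a < n i" "b < n i" for a b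
    unfolding Omega_def Diag_def mult_mat_diag_transpose_add_index[OF Z[OF i] \<Lambda> that]
    by (intro continuous_intros)
  have cont_v: "continuous_on ?S (\<lambda>x. vec_index (?v x) a)" if "a < n i" for a
  proof -
    have "vec_index (?v x) a
        = vec_index (Y i) a - (\<Sum>k<CARD('p). X i $$ (a, k) * fst x $ from_nat_into UNIV k)" for x
      using X[OF i] Y[OF i] that by (simp add: scalar_prod_def coords_def atLeast0LessThan)
    then show ?thesis by (auto intro!: continuous_intros)
  qed
  \<comment> \<open>The quadratic form is written as a finite double sum, so that continuity of
    real-valued entries suffices.\<close>
  have "continuous_on ?S (\<lambda>x. \<Sum>a<n i. vec_index (?v x) a
      * (\<Sum>b<n i. inv_mat (?O x) $$ (a, b) * vec_index (?v x) b))"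
    by (intro continuous_intros cont_v continuous_on_inv_mat[OF O cont_O])
      (use O_pos in \<open>auto simp: less_le\<close>)
  moreover have "?v x \<bullet> (inv_mat (?O x) *\<^sub>v ?v x)
      = (\<Sum>a<n i. vec_index (?v x) a * (\<Sum>b<n i. inv_mat (?O x) $$ (a, b) * vec_index (?v x) b))"
    if "x \<in> ?S" for x
    using v[of x] inv[OF that]
    by (simp add: scalar_prod_def atLeast0LessThan del: index_minus_vec)
  ultimately have "continuous_on ?S (\<lambda>x. ?v x \<bullet> (inv_mat (?O x) *\<^sub>v ?v x))"
    by (simp cong: continuous_on_cong)
  then show "continuous_on ?S (\<lambda>x. 1/2 * (?v x \<bullet> (inv_mat (?O x) *\<^sub>v ?v x))
      + 1/2 * ln (Determinant.det (?O x)))"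
    by (intro continuous_intros continuous_on_det[OF O cont_O]) (use O_pos in \<open>auto simp: less_le\<close>)
qed

section \<open>Level compactness and existence of minimizers\<close>

lemma level_compact_on_add_continuous:
  fixes F :: "'a::metric_space \<Rightarrow> ereal" and g :: "'a \<Rightarrow> real"
  assumes F: "level_compact_on S F" and S: "closed S"
    and g: "continuous_on S g" and c: "\<And>x. x \<in> S \<Longrightarrow> c \<le> g x"
  shows "level_compact_on S (\<lambda>x. ereal (g x) + F x)"
  unfolding level_compact_on_def
proof (intro conjI allI)
  \<comment> \<open>As \<open>g x\<close> is finite, it moves across the inequality even where
    \<open>F x\<close> is infinite.\<close>
  have iff: "ereal (g x) + F x \<le> ereal \<nu> \<longleftrightarrow> F x \<le> ereal (\<nu> - g x)" for x \<nu>
    by (cases "F x") auto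
  \<comment> \<open>The map is continuous only over \<open>S\<close>; the preimage is closed because
    \<open>S\<close> is.\<close>
  have "closed ((S \<times> UNIV) \<inter> (\<lambda>(x, \<nu>). (x, \<nu> - g x)) -` {(x, \<nu>::real). x \<in> S \<and> F x \<le> ereal \<nu>})"
    unfolding case_prod_beta'
  proof (rule continuous_closed_preimage)
    show "continuous_on (S \<times> UNIV) (\<lambda>x. (fst x, snd x - g (fst x)))"
      by (intro continuous_intros continuous_on_compose2[OF g]) auto
    show "closed {x. fst x \<in> S \<and> F (fst x) \<le> ereal (snd x)}"
      using F by (simp add: level_compact_on_def case_prod_beta')
  qed (intro closed_Times S closed_UNIV)
  also have "(S \<times> UNIV) \<inter> (\<lambda>(x, \<nu>). (x, \<nu> - g x)) -` {(x, \<nu>::real). x \<in> S \<and> F x \<le> ereal \<nu>}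
      = {(x, \<nu>). x \<in> S \<and> ereal (g x) + F x \<le> ereal \<nu>}"
    by (auto simp: iff)
  finally show "closed {(x, \<nu>). x \<in> S \<and> ereal (g x) + F x \<le> ereal \<nu>}" .
  fix \<nu> :: real
  \<comment> \<open>Here \<open>\<nu> - g x \<le> \<nu> - c\<close>.\<close>
  have "{x \<in> S. ereal (g x) + F x \<le> ereal \<nu>} \<subseteq> {x \<in> S. F x \<le> ereal (\<nu> - c)}"
    using c by (fastforce simp: iff intro: order_trans)
  then show "bounded {x \<in> S. ereal (g x) + F x \<le> ereal \<nu>}"
    using F bounded_subset unfolding level_compact_on_def by blast
qed

text \<open>A point common to all sublevel sets above the infimum attains it. The argument covers an
  infimum of \<open>-\<infinity>\<close> without a separate case.\<close>

lemma level_compact_on_imp_minimizer: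
  fixes F :: "'a::heine_borel \<Rightarrow> ereal"
  assumes F: "level_compact_on S F" and S: "S \<noteq> {}"
  shows "\<exists>x. is_minimizer_on S F x"
proof -
  define I where "I = (INF y\<in>S. F y)"
  define C where "C \<nu> = {x \<in> S. F x \<le> ereal \<nu>}" for \<nu> :: real
  have compact: "compact (C \<nu>)" for \<nu>
  proof -
    \<comment> \<open>The sublevel set is the slice of the epigraph at height \<nu>.\<close>
    have "closed ((\<lambda>x. (x, \<nu>)) -` {(x, \<nu>). x \<in> S \<and> F x \<le> ereal \<nu>})"
      using F by (intro closed_vimage continuous_intros) (simp add: level_compact_on_def)
    then show ?thesis
      using F by (simp add: C_def level_compact_on_def compact_eq_bounded_closed vimage_def)
  qed
  have "\<exists>x\<in>S. F x \<le> I"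
  \<comment> \<open>With infinite \<open>I\<close> there are no real levels above it, but every
    point of \<open>S\<close> is then a minimizer.\<close>
  proof (cases "I = \<infinity>")
    case True
    then show ?thesis using S by auto
  next
    case False
    let ?\<C> = "C ` {\<nu>. I < ereal \<nu>}"
    have "\<Inter> ?\<C> \<noteq> {}"
    proof (rule compact_chain)
      \<comment> \<open>A level above the infimum is undercut by some value of
        \<open>F\<close>.\<close>
      show "{} \<notin> ?\<C>"
        unfolding C_def I_def INF_less_iff by (auto dest: less_imp_le)
      show "A \<subseteq> B \<or> B \<subseteq> A" if AB: "A \<in> ?\<C> \<and> B \<in> ?\<C>" for A B
      proof -
        have "C \<mu> \<subseteq> C \<nu>" if "\<mu> \<le> \<nu>" for \<mu> \<nu>
          using that by (auto simp: C_def intro: order_trans)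
        then show ?thesis using AB by (metis imageE linear)
      qed
    qed (use compact in auto)
    then obtain x where x: "\<And>\<nu>. I < ereal \<nu> \<Longrightarrow> x \<in> C \<nu>" by auto
    obtain \<nu> where "I < ereal \<nu>"
      using ereal_dense2[of I \<infinity>] False by auto
    then have "x \<in> S" using x by (auto simp: C_def)
    moreover have "F x \<le> I"
    proof (rule ccontr)
      \<comment> \<open>A real level strictly between \<open>I\<close> and \<open>F x\<close> would
        have a sublevel set that both contains and excludes \<open>x\<close>.\<close>
      assume "\<not> F x \<le> I"
      then have "I < F x" by simp
      then obtain \<mu> where "I < ereal \<mu>" "ereal \<mu> < F x"
        using ereal_dense2[of I "F x"] by auto
      then show False using x[of \<mu>] by (auto simp: C_def)
    qed
    ultimately show ?thesis by auto
  qed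
  then show ?thesis
    unfolding is_minimizer_on_def I_def by (metis INF_lower antisym)
qed

lemma closed_nonneg_orthant: "closed nonneg_orthant"
  unfolding nonneg_orthant_def by (intro closed_Collect_all closed_Collect_le continuous_intros)

theorem theorem2:
  fixes m :: nat and n :: "nat \<Rightarrow> nat"
    and X Z \<Lambda> :: "nat \<Rightarrow> real mat" and Y :: "nat \<Rightarrow> real Matrix.vec"
    and R :: "(real^'p) \<times> (real^'q) \<Rightarrow> ereal"
  assumes "m \<ge> 1"
    and "\<And>i. i \<in> {1..m} \<Longrightarrow> n i \<ge> 1"
    and "\<And>i. i \<in> {1..m} \<Longrightarrow> X i \<in> carrier_mat (n i) CARD('p)"
    and "\<And>i. i \<in> {1..m} \<Longrightarrow> Z i \<in> carrier_mat (n i) CARD('q)"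
    and "\<And>i. i \<in> {1..m} \<Longrightarrow> Y i \<in> carrier_vec (n i)"
    and "\<And>i. i \<in> {1..m} \<Longrightarrow> sym_pos_def (n i) (\<Lambda> i)"
    and "\<And>x. x \<in> UNIV \<times> nonneg_orthant \<Longrightarrow> R x \<noteq> -\<infinity>"
    and "lower_semicontinuous_on (UNIV \<times> nonneg_orthant) R"
    and "level_compact_on (UNIV \<times> nonneg_orthant) R"
  shows "level_compact_on (UNIV \<times> nonneg_orthant)
           (\<lambda>x. ereal (neg_log_lik m X Z Y \<Lambda> x) + R x)
       \<and> (\<exists>x. is_minimizer_on (UNIV \<times> nonneg_orthant)
           (\<lambda>x. ereal (neg_log_lik m X Z Y \<Lambda> x) + R x) x)"
proof -
  let ?F = "\<lambda>x. ereal (neg_log_lik m X Z Y \<Lambda> x) + R x"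
  \<comment> \<open>The lower bound \<open>c\<close> is the sum of the halved log determinants of
    the \<open>\<Lambda> i\<close>.\<close>
  have compact: "level_compact_on (UNIV \<times> nonneg_orthant) ?F"
    by (rule level_compact_on_add_continuous[OF assms(9) closed_Times[OF closed_UNIV closed_nonneg_orthant]
          continuous_on_neg_log_lik[OF assms(3-6)] neg_log_lik_bounded_below[OF assms(3,4,6)]])
  \<comment> \<open>The origin witnesses that the feasible set is nonempty.\<close>
  moreover have "0 \<in> (UNIV \<times> nonneg_orthant :: ((real^'p) \<times> (real^'q)) set)"
    by (simp add: nonneg_orthant_def zero_prod_def)
  then have "\<exists>x. is_minimizer_on (UNIV \<times> nonneg_orthant) ?F x"
    by (intro level_compact_on_imp_minimizer[OF compact]) auto
  ultimately show ?thesis by blast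
qed

end
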